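(* Let $r,t$ be integers with $2\le r-1\le t$. Then $\mathrm{cov}(r,r+t)\le t+2$.
   Context: A complete $r$-uniform $r$-partite hypergraph $K$ has a vertex set $V=V(K)$ partitioned into nonempty classes $V_1\cup\dots\cup V_r$, and its edges are exactly the sets containing one vertex from each class. A $k$-coloring of a hypergraph is an assignment of a color from $[k]=\{1,\dots,k\}$ to each edge (not all $k$ colors need be used). A coloring is spanning if every vertex is incident to edges of every color used in the coloring. For an edge-colored hypergraph $H$, let $H_i$ be the subhypergraph on vertex set $V(H)$ consisting of the edges of color $i$. A hypergraph is connected if it has only one vertex or any two distinct vertices can be connected by a sequence of edges each intersecting the next; every hypergraph is uniquely partitioned into connected components. A monochromatic component of $H$ is (the vertex set of) a connected component of $H_i$ for some color $i$. Let $c(H)$ be the minimum integer $m$ such that $V(H)$ can be covered by $m$ monochromatic components of $H$. $\mathrm{cov}(r,k)$ is the maximum of $c(K)$ when $K$ ranges over all spanning $k$-colorings of complete $r$-uniform $r$-partite hypergraphs. *)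

theory Defs
  imports "HOL-Library.Disjoint_Sets" "HOL-Library.Extended_Nat"
begin

text \<open>A hypergraph is given by its vertex set and its set of edges (sets of vertices);
  vertex sets are allowed to be infinite.\<close>

definition complete_partite :: "nat \<Rightarrow> 'a set \<Rightarrow> 'a set set \<Rightarrow> bool" where
  "complete_partite r V E \<longleftrightarrow>
    (\<exists>P. partition_on V P \<and> finite P \<and> card P = r \<and>
         E = {e. e \<subseteq> V \<and> (\<forall>A\<in>P. card (e \<inter> A) = 1)})"

definition edge_coloring :: "nat \<Rightarrow> 'a set set \<Rightarrow> ('a set \<Rightarrow> nat) \<Rightarrow> bool" where
  "edge_coloring k E c \<longleftrightarrow> (\<forall>e\<in>E. c e \<in> {1..k})"

definition color_class :: "'a set set \<Rightarrow> ('a set \<Rightarrow> nat) \<Rightarrow> nat \<Rightarrow> 'a set set" where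
  "color_class E c i = {e \<in> E. c e = i}"

text \<open>The colors used are those in \<open>c ` E\<close>, possibly fewer than \<open>k\<close>.\<close>

definition spanning :: "'a set \<Rightarrow> 'a set set \<Rightarrow> ('a set \<Rightarrow> nat) \<Rightarrow> bool" where
  "spanning V E c \<longleftrightarrow> (\<forall>v\<in>V. \<forall>i\<in>c ` E. \<exists>e\<in>color_class E c i. v \<in> e)"

definition joined :: "'a set set \<Rightarrow> 'a \<Rightarrow> 'a \<Rightarrow> bool" where
  "joined E u v \<longleftrightarrow>
    (\<exists>es. es \<noteq> [] \<and> set es \<subseteq> E \<and> u \<in> hd es \<and> v \<in> last es \<and>
          successively (\<lambda>e f. e \<inter> f \<noteq> {}) es)"

definition hconnected :: "'a set \<Rightarrow> 'a set set \<Rightarrow> bool" where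
  "hconnected V E \<longleftrightarrow> card V = 1 \<or> (\<forall>u\<in>V. \<forall>v\<in>V. u \<noteq> v \<longrightarrow> joined E u v)"

text \<open>Vertex sets of connected components: the maximal nonempty sets of vertices whose induced
  subhypergraph is connected. A vertex lying in no edge forms a component by itself.\<close>

definition components :: "'a set \<Rightarrow> 'a set set \<Rightarrow> 'a set set" where
  "components V E =
    {W. W \<noteq> {} \<and> W \<subseteq> V \<and> hconnected W {e \<in> E. e \<subseteq> W} \<and>
        (\<forall>W'. W \<subseteq> W' \<and> W' \<subseteq> V \<and> hconnected W' {e \<in> E. e \<subseteq> W'} \<longrightarrow> W' = W)}"

definition monochromatic_components ::
    "nat \<Rightarrow> 'a set \<Rightarrow> 'a set set \<Rightarrow> ('a set \<Rightarrow> nat) \<Rightarrow> 'a set set" where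
  "monochromatic_components k V E c = (\<Union>i\<in>{1..k}. components V (color_class E c i))"

text \<open>Minima and maxima are taken in \<^typ>\<open>enat\<close>: the value is \<open>\<infinity>\<close> if no finite cover exists,
  respectively if the cover numbers are unbounded.\<close>

definition cover_number ::
    "nat \<Rightarrow> 'a set \<Rightarrow> 'a set set \<Rightarrow> ('a set \<Rightarrow> nat) \<Rightarrow> enat" where
  "cover_number k V E c =
    Inf {enat (card S) | S. finite S \<and> S \<subseteq> monochromatic_components k V E c \<and> V \<subseteq> \<Union>S}"

text \<open>The type argument is the type that the vertices are taken from.\<close>

definition cov :: "'a itself \<Rightarrow> nat \<Rightarrow> nat \<Rightarrow> enat" where
  "cov T r k =
    Sup {cover_number k V E c | (V :: 'a set) E c.
           complete_partite r V E \<and> edge_coloring k E c \<and> spanning V E c}"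

text \<open>The components of a hypergraph partition its vertex set, and they are the classes of the
  relation of being equal or joined by a sequence of edges.\<close>

lemma joined_edge: "e \<in> E \<Longrightarrow> u \<in> e \<Longrightarrow> v \<in> e \<Longrightarrow> joined E u v"
  unfolding joined_def by (intro exI[of _ "[e]"]) auto

lemma joined_mono: "joined E u v \<Longrightarrow> E \<subseteq> F \<Longrightarrow> joined F u v"
  unfolding joined_def by blast

lemma joined_sym: "joined E u v \<Longrightarrow> joined E v u"
  unfolding joined_def
proof (elim exE conjE)
  fix es assume *: "es \<noteq> []" "set es \<subseteq> E" "u \<in> hd es" "v \<in> last es"
    "successively (\<lambda>e f. e \<inter> f \<noteq> {}) es"
  have "successively (\<lambda>e f. f \<inter> e \<noteq> {}) es" using *(5) by (simp add: Int_commute)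
  then show "\<exists>es. es \<noteq> [] \<and> set es \<subseteq> E \<and> v \<in> hd es \<and> u \<in> last es \<and>
          successively (\<lambda>e f. e \<inter> f \<noteq> {}) es"
    using * by (intro exI[of _ "rev es"]) (auto simp: hd_rev last_rev)
qed

lemma joined_trans: "joined E u v \<Longrightarrow> joined E v w \<Longrightarrow> joined E u w"
  unfolding joined_def
proof (elim exE conjE)
  fix es fs assume *: "es \<noteq> []" "set es \<subseteq> E" "u \<in> hd es" "v \<in> last es"
    "successively (\<lambda>e f. e \<inter> f \<noteq> {}) es"
    "fs \<noteq> []" "set fs \<subseteq> E" "v \<in> hd fs" "w \<in> last fs"
    "successively (\<lambda>e f. e \<inter> f \<noteq> {}) fs"
  then show "\<exists>es. es \<noteq> [] \<and> set es \<subseteq> E \<and> u \<in> hd es \<and> w \<in> last es \<and>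
          successively (\<lambda>e f. e \<inter> f \<noteq> {}) es"
    by (intro exI[of _ "es @ fs"]) (auto simp: successively_append_iff)
qed

lemma joined_within:
  assumes "joined E u v"
  shows "joined {e \<in> E. e \<subseteq> {x. joined E u x}} u v"
proof -
  have "set es \<subseteq> E \<Longrightarrow> es \<noteq> [] \<Longrightarrow> u \<in> hd es \<Longrightarrow> successively (\<lambda>e f. e \<inter> f \<noteq> {}) es
    \<Longrightarrow> \<forall>e\<in>set es. e \<subseteq> {x. joined E u x}" for es
  proof (induction es rule: rev_induct)
    case (snoc f es)
    show ?case
    proof (cases "es = []")
      case True
      then show ?thesis using snoc.prems by (auto intro: joined_edge)
    next
      case False
      then have IH: "\<forall>e\<in>set es. e \<subseteq> {x. joined E u x}" and "last es \<inter> f \<noteq> {}"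
        using snoc by (auto simp: successively_append_iff)
      then obtain y where "joined E u y" "y \<in> f" using False last_in_set by blast
      then have "f \<subseteq> {x. joined E u x}"
        using snoc.prems by (auto intro: joined_trans joined_edge)
      then show ?thesis using IH by simp
    qed
  qed simp
  moreover obtain es where es: "es \<noteq> []" "set es \<subseteq> E" "u \<in> hd es" "v \<in> last es"
    "successively (\<lambda>e f. e \<inter> f \<noteq> {}) es"
    using assms unfolding joined_def by blast
  ultimately have "\<forall>e\<in>set es. e \<subseteq> {x. joined E u x}" by simp
  then have "set es \<subseteq> {e \<in> E. e \<subseteq> {x. joined E u x}}" using es(2) by blast
  then show ?thesis
    unfolding joined_def[of "{e \<in> E. e \<subseteq> {x. joined E u x}}"] using es by (intro exI[of _ es]) simp
qed

lemma components_eq_quotient: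
  assumes "\<forall>e\<in>E. e \<subseteq> V"
  shows "components V E = V // {(u, v). u \<in> V \<and> v \<in> V \<and> (u = v \<or> joined E u v)}"
proof -
  define R where "R = {(u, v). u \<in> V \<and> v \<in> V \<and> (u = v \<or> joined E u v)}"
  have in_V: "joined E u x \<Longrightarrow> x \<in> V" for u x
    using assms unfolding joined_def by (metis last_in_set subset_iff)
  have mem: "x \<in> R `` {u} \<longleftrightarrow> u \<in> V \<and> (x = u \<or> joined E u x)" for u x
    using in_V by (auto simp: R_def)
  have conn: "hconnected (R `` {u}) {e \<in> E. e \<subseteq> R `` {u}}" if "u \<in> V" for u
  proof -
    have *: "joined {e \<in> E. e \<subseteq> R `` {u}} u x" if "joined E u x" for x
      by (rule joined_mono[OF joined_within[OF that]]) (use \<open>u \<in> V\<close> mem in auto)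
    have "joined {e \<in> E. e \<subseteq> R `` {u}} x y" if "x \<in> R `` {u}" "y \<in> R `` {u}" "x \<noteq> y" for x y
    proof -
      have "x = u \<or> joined E u x" "y = u \<or> joined E u y" using that mem by auto
      then show ?thesis using *[of x] *[of y] \<open>x \<noteq> y\<close> by (auto intro: joined_sym joined_trans)
    qed
    then show ?thesis unfolding hconnected_def by blast
  qed
  have sub: "W \<subseteq> R `` {u}"
    if "W \<subseteq> V" "hconnected W {e \<in> E. e \<subseteq> W}" "u \<in> W" for W u
  proof
    fix x assume "x \<in> W"
    show "x \<in> R `` {u}"
    proof (cases "x = u")
      case False
      then have "card W \<noteq> 1" using \<open>x \<in> W\<close> \<open>u \<in> W\<close> by (auto simp: card_1_singleton_iff)
      then have "joined {e \<in> E. e \<subseteq> W} u x"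
        using that \<open>x \<in> W\<close> False unfolding hconnected_def by auto
      then have "joined E u x" by (rule joined_mono) blast
      then show ?thesis using mem that by blast
    qed (use mem that in blast)
  qed
  have RV: "R `` {u} \<subseteq> V" for u by (auto simp: R_def)
  have "W \<in> components V E \<longleftrightarrow> W \<in> V // R" for W
  proof
    assume W: "W \<in> components V E"
    then obtain u where "u \<in> W" "u \<in> V" unfolding components_def by blast
    then have "R `` {u} = W"
    proof -
      have "W \<subseteq> V" "hconnected W {e \<in> E. e \<subseteq> W}"
        and max: "\<And>W'. W \<subseteq> W' \<and> W' \<subseteq> V \<and> hconnected W' {e \<in> E. e \<subseteq> W'} \<Longrightarrow> W' = W"
        using W by (auto simp: components_def)
      then have "W \<subseteq> R `` {u}" using sub \<open>u \<in> W\<close> by simp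
      then show ?thesis using conn[OF \<open>u \<in> V\<close>] RV by (intro max) simp
    qed
    then show "W \<in> V // R" using \<open>u \<in> V\<close> by (auto simp: quotient_def)
  next
    assume "W \<in> V // R"
    then obtain u where u: "u \<in> V" "W = R `` {u}" by (auto simp: quotient_def)
    then have "u \<in> W" using mem by blast
    then show "W \<in> components V E"
    proof -
      have "W' = W" if "W \<subseteq> W'" "W' \<subseteq> V" "hconnected W' {e \<in> E. e \<subseteq> W'}" for W'
        using sub[OF that(2,3), of u] that(1) \<open>u \<in> W\<close> u(2) by auto
      moreover have "hconnected W {e \<in> E. e \<subseteq> W}" "W \<subseteq> V" using conn[OF u(1)] RV[of u] u(2) by simp_all
      moreover have "W \<noteq> {}" using \<open>u \<in> W\<close> by blast
      ultimately show ?thesis unfolding components_def by simp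
    qed
  qed
  then show ?thesis unfolding R_def by blast
qed

lemma partition_on_components:
  assumes "\<forall>e\<in>E. e \<subseteq> V"
  shows "partition_on V (components V E)"
proof -
  have "equiv V {(u, v). u \<in> V \<and> v \<in> V \<and> (u = v \<or> joined E u v)}"
    by (rule equivI) (auto simp: refl_on_def sym_def trans_def intro: joined_sym joined_trans)
  then show ?thesis
    unfolding components_eq_quotient[OF assms] by (rule partition_on_quotient)
qed

end

theory Submission
  imports Defs
begin

text \<open>Label every vertex, for each colour, by its monochromatic component in that colour. The
  vertices of a transversal of the classes form an edge, so they agree in some colour; since the
  colouring is spanning, every component meets every class. If some colour has at most two
  components, these cover. Otherwise take vertices \<open>v\<^sub>1\<close>, \<open>v\<^sub>2\<close> of different classes.

  If they differ in at least \<open>r - 2\<close> colours, use the remaining \<open>r - 2\<close> classes to turn \<open>r - 2\<close>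
  of these colours into colours in which three vertices of a transversal are pairwise distinct.
  Replacing one vertex of this transversal by an arbitrary \<open>v\<close>
  shows that \<open>v\<close> lies in a component containing \<open>r - 1\<close> vertices of the transversal. There is at
  most one such component per colour, and none in the \<open>r - 2\<close> spoiled colours.

  If they differ in at most \<open>r - 2\<close> colours, drop \<open>r - 2\<close> colours including these. The components
  of \<open>v\<^sub>1\<close> in the other colours are also those of \<open>v\<^sub>2\<close>, and they cover: a vertex \<open>v\<close> outside all of
  them lies in a different class from \<open>v\<^sub>1\<close> or from \<open>v\<^sub>2\<close>, and this pair could be extended, spending
  one class per dropped colour, to a transversal without agreement.\<close>

text \<open>An injection \<open>h\<close> from \<open>D\<close> into \<open>Q\<close> gives each
  class at most one condition to respect, so the representatives can be chosen independently of each
  other.\<close>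

lemma transversal_avoiding:
  assumes "finite D" "finite Q" "Q \<subseteq> P" "card D \<le> card Q"
    and nonempty: "\<And>A. A \<in> P \<Longrightarrow> A \<noteq> {}"
    and avoid: "\<And>i A. i \<in> D \<Longrightarrow> A \<in> P \<Longrightarrow> \<exists>u\<in>A. \<not> bad i u"
  obtains f h where "\<And>A. A \<in> P \<Longrightarrow> f A \<in> A" "\<And>i. i \<in> D \<Longrightarrow> h i \<in> Q"
    "\<And>i. i \<in> D \<Longrightarrow> \<not> bad i (f (h i))"
proof -
  obtain h where h: "inj_on h D" "h ` D \<subseteq> Q"
    using inj_on_iff_card_le[OF assms(1,2)] assms(4) by auto
  have "\<exists>u\<in>A. \<forall>i\<in>D. h i = A \<longrightarrow> \<not> bad i u" if "A \<in> P" for A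
  proof (cases "A \<in> h ` D")
    case True
    then obtain i where i: "i \<in> D" "A = h i" by blast
    then obtain u where "u \<in> A" "\<not> bad i u" using avoid \<open>A \<in> P\<close> by blast
    then show ?thesis using i h(1) by (metis inj_onD)
  next
    case False
    then show ?thesis using nonempty[OF \<open>A \<in> P\<close>] by blast
  qed
  then obtain f where "\<forall>A\<in>P. f A \<in> A \<and> (\<forall>i\<in>D. h i = A \<longrightarrow> \<not> bad i (f A))"
    using bchoice[of P "\<lambda>A u. u \<in> A \<and> (\<forall>i\<in>D. h i = A \<longrightarrow> \<not> bad i u)"] by blast
  then show thesis using that[of f h] h(2) \<open>Q \<subseteq> P\<close> by (auto simp: image_subset_iff subset_iff)
qed

text \<open>Hypergraph-free core: \<open>agree\<close> stands for transversals being coloured edges,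
  \<open>meet\<close> for the spanning property. The 2 in the bound pays for a colour with at most
  two labels.\<close>

lemma cover_by_labels:
  fixes P :: "'a set set" and C :: "'c set" and comp :: "'c \<Rightarrow> 'a \<Rightarrow> 'b"
  assumes P: "finite P" "3 \<le> card P" "\<And>A. A \<in> P \<Longrightarrow> A \<noteq> {}"
    and C: "finite C"
    and agree: "\<And>f. (\<And>A. A \<in> P \<Longrightarrow> f A \<in> A) \<Longrightarrow>
      \<exists>i\<in>C. \<forall>A\<in>P. \<forall>B\<in>P. comp i (f A) = comp i (f B)"
    and meet: "\<And>i v A. i \<in> C \<Longrightarrow> v \<in> \<Union>P \<Longrightarrow> A \<in> P \<Longrightarrow> \<exists>u\<in>A. comp i u = comp i v"
  obtains S where "finite S" "card S \<le> max 2 (card C - (card P - 2))"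
    "\<And>s. s \<in> S \<Longrightarrow> \<exists>i\<in>C. \<exists>v\<in>\<Union>P. s = comp i v"
    "\<And>v. v \<in> \<Union>P \<Longrightarrow> \<exists>i\<in>C. comp i v \<in> S"
proof (cases "\<exists>i\<in>C. \<exists>a b. comp i ` \<Union>P \<subseteq> {a, b}")
  case True
  then obtain i a b where i: "i \<in> C" "comp i ` \<Union>P \<subseteq> {a, b}" by blast
  have "card (comp i ` \<Union>P) \<le> card {a, b}" using i(2) by (intro card_mono) auto
  also have "\<dots> \<le> 2" by (simp add: card_insert_if)
  finally have "card (comp i ` \<Union>P) \<le> 2" .
  then show thesis
    using i finite_subset[OF i(2)] by (intro that[of "comp i ` \<Union>P"]) auto
next
  case False
  \<comment> \<open>Each colour now has a third label, and by \<open>meet\<close> it occurs in every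
    class.\<close>
  have avoid: "\<exists>u\<in>A. \<not> (comp i u = a \<or> comp i u = b)" if "i \<in> C" "A \<in> P" for i A a b
  proof -
    obtain v where "v \<in> \<Union>P" "comp i v \<notin> {a, b}" using False \<open>i \<in> C\<close> by blast
    then show ?thesis using meet[OF \<open>i \<in> C\<close> _ \<open>A \<in> P\<close>, of v] by force
  qed
  obtain A1 A2 where A: "A1 \<in> P" "A2 \<in> P" "A1 \<noteq> A2"
  proof -
    have "\<not> card P \<le> Suc 0" using P(2) by simp
    then show thesis using card_le_Suc0_iff_eq[OF P(1)] that by blast
  qed
  obtain v1 v2 where v: "v1 \<in> A1" "v2 \<in> A2" using A P(3) by blast
  define D where "D = {i \<in> C. comp i v1 \<noteq> comp i v2}"
  have "finite D" "D \<subseteq> C" using C by (auto simp: D_def)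
  have card_diff2: "card (P - {X, Y}) = card P - 2" if "X \<in> P" "Y \<in> P" "X \<noteq> Y" for X Y
    using that P(1) by (simp add: card_Diff_subset)
  show thesis
  proof (cases "card P - 2 \<le> card D")
    case True
    then obtain D' where D': "D' \<subseteq> D" "card D' = card P - 2"
      using obtain_subset_with_card_n by metis
    then have "finite D'" "D' \<subseteq> C" using \<open>finite D\<close> \<open>D \<subseteq> C\<close> finite_subset by auto
    obtain f h where f: "\<And>A. A \<in> P \<Longrightarrow> f A \<in> A" "\<And>i. i \<in> D' \<Longrightarrow> h i \<in> P - {A1, A2}"
      "\<And>i. i \<in> D' \<Longrightarrow> \<not> (comp i (f (h i)) = comp i v1 \<or> comp i (f (h i)) = comp i v2)"
    proof (rule transversal_avoiding[of D' "P - {A1, A2}" P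
            "\<lambda>i u. comp i u = comp i v1 \<or> comp i u = comp i v2"])
      show "finite D'" "finite (P - {A1, A2})" "P - {A1, A2} \<subseteq> P"
        using \<open>finite D'\<close> P(1) by auto
      show "card D' \<le> card (P - {A1, A2})" using D'(2) card_diff2[OF A] by simp
      show "\<exists>u\<in>X. \<not> (comp i u = comp i v1 \<or> comp i u = comp i v2)"
        if "i \<in> D'" "X \<in> P" for i X
        using avoid[of i X] that \<open>D' \<subseteq> C\<close> by blast
    qed (rule P(3), assumption, rule that)
    \<comment> \<open>\<open>h i\<close> is neither \<open>A1\<close> nor \<open>A2\<close>, so for
      \<open>i\<close> in \<open>D'\<close> the labels of \<open>e\<close> at \<open>A1\<close>,
      \<open>A2\<close> and \<open>h i\<close> are pairwise distinct.\<close>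
    define e where "e = f(A1 := v1, A2 := v2)"
    have e: "e A \<in> A" if "A \<in> P" for A using that f(1) v by (simp add: e_def)
    define maj where "maj i m \<longleftrightarrow> (\<exists>X\<in>P. \<forall>A\<in>P - {X}. comp i (e A) = m)" for i m
    have maj_unique: "m = m'" if "maj i m" "maj i m'" for i m m'
    proof -
      obtain X where X: "\<forall>A\<in>P - {X}. comp i (e A) = m"
        using \<open>maj i m\<close> unfolding maj_def by (elim bexE)
      obtain Y where Y: "\<forall>A\<in>P - {Y}. comp i (e A) = m'"
        using \<open>maj i m'\<close> unfolding maj_def by (elim bexE)
      have "\<not> P \<subseteq> {X, Y}"
      proof
        assume "P \<subseteq> {X, Y}"
        then have "card P \<le> card {X, Y}" by (intro card_mono) auto
        also have "\<dots> \<le> 2" by (simp add: card_insert_if)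
        finally show False using P(2) by simp
      qed
      then obtain A where "A \<in> P - {X}" "A \<in> P - {Y}" by blast
      then show ?thesis using X Y by metis
    qed
    \<comment> \<open>Without a majority label \<open>THE\<close> is unspecified; the intersection
      removes values that are not labels.\<close>
    define S where "S = (\<lambda>i. THE m. maj i m) ` (C - D') \<inter> {comp i v |i v. i \<in> C \<and> v \<in> \<Union>P}"
    show thesis
    proof (rule that[of S])
      have "card S \<le> card (C - D')"
        unfolding S_def using C by (meson card_image_le card_mono finite_Diff finite_imageI
            inf_le1 le_trans)
      also have "\<dots> = card C - (card P - 2)"
        using D'(2) \<open>finite D'\<close> \<open>D' \<subseteq> C\<close> by (simp add: card_Diff_subset)
      finally show "card S \<le> max 2 (card C - (card P - 2))" by simp
      show "finite S" using C by (simp add: S_def)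
      show "\<exists>i\<in>C. \<exists>v\<in>\<Union>P. s = comp i v" if "s \<in> S" for s using that by (auto simp: S_def)
      show "\<exists>i\<in>C. comp i v \<in> S" if "v \<in> \<Union>P" for v
      proof -
        obtain X where X: "X \<in> P" "v \<in> X" using \<open>v \<in> \<Union>P\<close> by blast
        have "(e(X := v)) A \<in> A" if "A \<in> P" for A using that e X by simp
        then obtain i where i: "i \<in> C"
          "\<forall>A\<in>P. \<forall>B\<in>P. comp i ((e(X := v)) A) = comp i ((e(X := v)) B)"
          using agree[of "e(X := v)"] by blast
        have eq: "comp i (e A) = comp i v" if "A \<in> P - {X}" for A
          using i(2)[rule_format, of A X] that X by simp
        \<comment> \<open>Changing \<open>e\<close> at the single class \<open>X\<close> leaves two
          of the three distinct labels in place.\<close>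
        have "i \<notin> D'"
        proof
          assume "i \<in> D'"
          then have "comp i v1 \<noteq> comp i v2" using D'(1) by (auto simp: D_def)
          then have "comp i (e A1) \<noteq> comp i (e A2)" using A by (simp add: e_def)
          moreover have "h i \<in> P" "h i \<noteq> A1" "h i \<noteq> A2" using f(2)[OF \<open>i \<in> D'\<close>] by auto
          moreover from this have "comp i (e (h i)) \<noteq> comp i (e A1)" "comp i (e (h i)) \<noteq> comp i (e A2)"
            using f(3)[OF \<open>i \<in> D'\<close>] A by (simp_all add: e_def)
          ultimately show False
            using eq[of A1] eq[of A2] eq[of "h i"] A by (cases "X = A1"; cases "X = A2") auto
        qed
        moreover have "maj i (comp i v)" using eq X unfolding maj_def by blast
        then have "comp i v = (THE m. maj i m)" using maj_unique by (intro the_equality[symmetric]) auto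
        ultimately have "comp i v \<in> (\<lambda>i. THE m. maj i m) ` (C - D')" using i(1) by (intro image_eqI) auto
        then show ?thesis using i(1) \<open>v \<in> \<Union>P\<close> unfolding S_def by blast
      qed
    qed
  next
    case False
    \<comment> \<open>The minimum allows for fewer than \<open>card P - 2\<close> colours; then
      \<open>D' = C\<close>, and both \<open>C - D'\<close> and the truncated bound vanish.\<close>
    have "\<exists>D'. D \<subseteq> D' \<and> D' \<subseteq> C \<and> card D' = min (card P - 2) (card C)"
      using False \<open>D \<subseteq> C\<close> C card_mono[OF C \<open>D \<subseteq> C\<close>]
      by (intro exists_subset_between) auto
    then obtain D' where D': "D \<subseteq> D'" "D' \<subseteq> C" "card D' = min (card P - 2) (card C)"
      by blast
    have "finite D'" using D'(2) C finite_subset by blast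
    define S where "S = (\<lambda>i. comp i v1) ` (C - D')"
    \<comment> \<open>Each colour of \<open>D'\<close> is spoiled in its own class outside
      \<open>X\<close> and \<open>Y\<close>, which forces the agreement into
      \<open>C - D'\<close>.\<close>
    have covered: "\<exists>i\<in>C - D'. comp i v = comp i w"
      if "X \<in> P" "v \<in> X" "Y \<in> P" "w \<in> Y" "X \<noteq> Y" for X Y v w
    proof -
      obtain f h where f: "\<And>A. A \<in> P \<Longrightarrow> f A \<in> A" "\<And>i. i \<in> D' \<Longrightarrow> h i \<in> P - {X, Y}"
        "\<And>i. i \<in> D' \<Longrightarrow> \<not> comp i (f (h i)) = comp i w"
      proof (rule transversal_avoiding[of D' "P - {X, Y}" P "\<lambda>i u. comp i u = comp i w"])
        show "finite D'" "finite (P - {X, Y})" "P - {X, Y} \<subseteq> P"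
          using \<open>finite D'\<close> P(1) by auto
        show "card D' \<le> card (P - {X, Y})"
          using D'(3) card_diff2[OF \<open>X \<in> P\<close> \<open>Y \<in> P\<close> \<open>X \<noteq> Y\<close>] by simp
        show "\<exists>u\<in>Z. \<not> comp i u = comp i w" if "i \<in> D'" "Z \<in> P" for i Z
          using avoid[of i Z] that D'(2) by blast
      qed (rule P(3), assumption, rule that)
      define e where "e = f(X := v, Y := w)"
      have "e A \<in> A" if "A \<in> P" for A
        using f(1)[OF \<open>A \<in> P\<close>] \<open>v \<in> X\<close> \<open>w \<in> Y\<close> by (simp add: e_def)
      then obtain i where i: "i \<in> C" "\<forall>A\<in>P. \<forall>B\<in>P. comp i (e A) = comp i (e B)"
        using agree[of e] by blast
      have "i \<notin> D'"
      proof
        assume "i \<in> D'"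
        then show False
          using f(2,3)[OF \<open>i \<in> D'\<close>] i(2)[rule_format, of "h i" Y] \<open>Y \<in> P\<close> by (auto simp: e_def)
      qed
      moreover have "comp i v = comp i w"
        using i(2)[rule_format, of X Y] that by (simp add: e_def)
      ultimately show ?thesis using i(1) by blast
    qed
    show thesis
    proof (rule that[of S])
      have "card S \<le> card (C - D')" unfolding S_def using C by (simp add: card_image_le)
      also have "\<dots> \<le> card C - (card P - 2)"
        using D'(2,3) \<open>finite D'\<close> by (simp add: card_Diff_subset)
      finally show "card S \<le> max 2 (card C - (card P - 2))" by simp
      show "finite S" using C by (simp add: S_def)
      show "\<exists>i\<in>C. \<exists>v\<in>\<Union>P. s = comp i v" if "s \<in> S" for s
        using that v A by (auto simp: S_def)
      show "\<exists>i\<in>C. comp i v \<in> S" if "v \<in> \<Union>P" for v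
      proof -
        obtain X where X: "X \<in> P" "v \<in> X" using \<open>v \<in> \<Union>P\<close> by blast
        have "comp i v1 = comp i v2" if "i \<in> C - D'" for i
          using that D'(1) by (auto simp: D_def)
        \<comment> \<open>\<open>X\<close> differs from \<open>A1\<close> or from \<open>A2\<close>;
          in the latter case the label of \<open>v2\<close> is that of \<open>v1\<close>.\<close>
        then have "\<exists>i\<in>C - D'. comp i v = comp i v1"
          using covered[OF X A(1) v(1)] covered[OF X A(2) v(2)] A(3) by metis
        then show ?thesis by (auto simp: S_def)
      qed
    qed
  qed
qed

text \<open>The labels are the classes of the joinedness relation, which are exactly the
  components.\<close>

lemma cover_number_le:
  fixes V :: "'a set"
  assumes "complete_partite r V E" "edge_coloring k E c" "spanning V E c" "3 \<le> r"
  shows "cover_number k V E c \<le> enat (max 2 (k - (r - 2)))"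
proof -
  obtain P where P: "partition_on V P" "finite P" "card P = r"
    and E: "E = {e. e \<subseteq> V \<and> (\<forall>A\<in>P. card (e \<inter> A) = 1)}"
    using assms(1) unfolding complete_partite_def by blast
  have V: "\<Union>P = V" using P(1) by (simp add: partition_on_def)
  \<comment> \<open>Only used colours are taken, since \<open>spanning\<close> speaks of these; the
    bound is monotone in their number.\<close>
  define C where "C = c ` E"
  have "C \<subseteq> {1..k}" using assms(2) by (auto simp: C_def edge_coloring_def)
  then have C: "finite C" "card C \<le> k"
    using finite_subset card_mono[of "{1..k}" C] by auto
  define R where "R i = {(u, v). u \<in> V \<and> v \<in> V \<and> (u = v \<or> joined (color_class E c i) u v)}" for i
  have equiv: "equiv V (R i)" for i
    by (rule equivI) (auto simp: R_def refl_on_def sym_def trans_def intro: joined_sym joined_trans)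
  define comp where "comp i v = R i `` {v}" for i v
  have edge: "comp i u = comp i v" if "e \<in> color_class E c i" "u \<in> e" "v \<in> e" for i e u v
  proof -
    have "u \<in> V" "v \<in> V" using that E by (auto simp: color_class_def)
    then have "(u, v) \<in> R i" using joined_edge[OF that] by (simp add: R_def)
    then show ?thesis unfolding comp_def by (rule equiv_class_eq[OF equiv])
  qed
  obtain S where S: "finite S" "card S \<le> max 2 (card C - (card P - 2))"
    "\<And>s. s \<in> S \<Longrightarrow> \<exists>i\<in>C. \<exists>v\<in>V. s = comp i v"
    "\<And>v. v \<in> V \<Longrightarrow> \<exists>i\<in>C. comp i v \<in> S"
  proof (rule cover_by_labels[of P C comp, unfolded V])
    show "finite P" "3 \<le> card P" "finite C" using P assms(4) C by auto
    show "A \<noteq> {}" if "A \<in> P" for A using that P(1) by (auto simp: partition_on_def)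
    show "\<exists>i\<in>C. \<forall>A\<in>P. \<forall>B\<in>P. comp i (f A) = comp i (f B)" if f: "\<And>A. A \<in> P \<Longrightarrow> f A \<in> A" for f
    proof -
      \<comment> \<open>Disjointness of the classes makes the transversal an edge, and its own
        colour is where the labels agree.\<close>
      have "f ` P \<inter> A = {f A}" if "A \<in> P" for A
      proof -
        have "B = A" if "B \<in> P" "f B \<in> A" for B
          using that f[of B] \<open>A \<in> P\<close> P(1) by (auto simp: partition_on_def disjoint_def)
        then show ?thesis using f \<open>A \<in> P\<close> by auto
      qed
      then have "f ` P \<in> E" using f V unfolding E by auto
      then have "f ` P \<in> color_class E c (c (f ` P))" "c (f ` P) \<in> C"
        by (auto simp: color_class_def C_def)
      then show ?thesis using edge by blast
    qed
    show "\<exists>u\<in>A. comp i u = comp i v" if "i \<in> C" "v \<in> V" "A \<in> P" for i v A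
    proof -
      have "i \<in> c ` E" using that by (simp add: C_def)
      then obtain e where e: "e \<in> color_class E c i" "v \<in> e"
        using assms(3) \<open>v \<in> V\<close> unfolding spanning_def by blast
      then have "card (e \<inter> A) = 1" using \<open>A \<in> P\<close> by (auto simp: E color_class_def)
      then obtain u where "u \<in> e" "u \<in> A" by (metis Int_iff card_1_singletonE singletonI)
      then show ?thesis using edge e by blast
    qed
  qed (rule that)
  have "S \<subseteq> monochromatic_components k V E c"
  proof
    fix s assume "s \<in> S"
    then obtain i v where iv: "i \<in> C" "v \<in> V" "s = comp i v" using S(3) by blast
    have "components V (color_class E c i) = V // R i"
      unfolding R_def by (rule components_eq_quotient) (auto simp: E color_class_def)
    then have "s \<in> components V (color_class E c i)"
      using iv by (auto simp: comp_def intro: quotientI)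
    then show "s \<in> monochromatic_components k V E c"
      using iv(1) \<open>C \<subseteq> {1..k}\<close> unfolding monochromatic_components_def by blast
  qed
  moreover have "V \<subseteq> \<Union>S"
  proof
    fix v assume "v \<in> V"
    then obtain i where "comp i v \<in> S" using S(4) by blast
    moreover have "v \<in> comp i v" using equiv_class_self[OF equiv \<open>v \<in> V\<close>] by (simp add: comp_def)
    ultimately show "v \<in> \<Union>S" by blast
  qed
  ultimately have "cover_number k V E c \<le> enat (card S)"
    unfolding cover_number_def using S(1) by (intro Inf_lower) blast
  also have "\<dots> \<le> enat (max 2 (k - (r - 2)))"
    using S(2) C(2) P(3) by (simp del: max.bounded_iff)
  finally show ?thesis .
qed

theorem theorem2p6:
  fixes r t :: nat
  assumes "2 \<le> r - 1" and "r - 1 \<le> t"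
  shows "cov TYPE('a) r (r + t) \<le> enat (t + 2)"
proof -
  have "3 \<le> r" "max 2 (r + t - (r - 2)) = t + 2" using assms by simp_all
  then show ?thesis
    unfolding cov_def using cover_number_le[of r _ _ "r + t"]
    by (intro Sup_least) fastforce
qed

end
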